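(* Let $(X,X_+,\mathcal{K},f)$ be an abstract state space and let $P$ be a Markov projection of $X$. Let $\mathfrak{S}_P(X)$ be the set of all sequences $\mathcal{T}=\{T_n\}_{n=1}^\infty$ of Markov operators on $X$ with $T_nP=PT_n$ and $T_nP=P$ for all $n\in\mathbb{N}$, endowed with the metric $$d(\mathcal{T},\mathcal{S})=\sum_{n=1}^\infty\frac{\|T_n-S_n\|}{2^n},\qquad \mathcal{T}=\{T_n\},\ \mathcal{S}=\{S_n\}.$$ Let $\mathfrak{S}_P^u(X)$ be the set of those $\mathcal{T}\in\mathfrak{S}_P(X)$ for which the NDMC $\{T^{m,n}\}$ generated by $\mathcal{T}$ is uniformly $P$-ergodic. Then $\mathfrak{S}_P^u(X)$ is a dense subset of $\mathfrak{S}_P(X)$.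
   Context: Abstract state space: $X$ is a real ordered vector space with generating cone $X_+=\{x\in X: x\ge 0\}$ (i.e. $X=X_+-X_+$), $f$ is a strictly positive linear functional on $X$ ($f(x)>0$ for $x>0$), and $\mathcal{K}=\{x\in X_+: f(x)=1\}$. With $U$ the convex hull of $\mathcal{K}\cup(-\mathcal{K})$, put $\|x\|=\inf\{\lambda\in\mathbb{R}_+: x\in\lambda U\}$. $(X,X_+,\mathcal{K},f)$ is an abstract state space if $\|\cdot\|$ is a norm, $X$ is complete for it, and $X_+$ is closed. $X$ always carries this norm, and norms of operators are the induced operator norms. Markov operator: a linear $T:X\to X$ that is positive and satisfies $T(\mathcal{K})\subset\mathcal{K}$ (then $\|T\|=1$). Markov projection: a Markov operator $P$ with $P^2=P$. $\mathbb{N}=\{1,2,\dots\}$. The nonhomogeneous discrete Markov chain (NDMC) generated by $\{T_n\}_{n\ge1}$ is the family $T^{k,n}=T_nT_{n-1}\cdots T_{k+1}$, $0\le k<n$. It is uniformly $P$-ergodic if $\lim_{n\to\infty}\|T^{m,n}-P\|=0$ for every $m\ge0$. *)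

theory Defs
  imports "HOL-Analysis.Analysis"
begin

text \<open>
  The ordered vector space \<open>X\<close> is a type \<open>'a\<close> of sort \<open>{banach, ordered_real_vector}\<close>, its cone
  \<open>X\<^sub>+\<close> is \<open>{x. 0 \<le> x}\<close>. The sort supplies a complete norm; the assumption \<open>norm_gauge\<close> of the
  locale \<open>abstract_state_space\<close> identifies it with the gauge of the convex hull of
  \<open>K \<union> (- K)\<close>, so that operator norms and topology are those of the abstract state space.
\<close>

definition base :: "('a::ordered_real_vector \<Rightarrow> real) \<Rightarrow> 'a set" where
  "base f = {x. 0 \<le> x \<and> f x = 1}"

definition gauge_ball :: "('a::ordered_real_vector \<Rightarrow> real) \<Rightarrow> 'a set" where
  "gauge_ball f = convex hull (base f \<union> uminus ` base f)"

locale abstract_state_space =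
  fixes f :: "'a::{banach, ordered_real_vector} \<Rightarrow> real"
  assumes generating: "\<exists>a b. 0 \<le> a \<and> 0 \<le> b \<and> x = a - b"
    and linear_f: "linear f"
    and strictly_positive: "0 < x \<Longrightarrow> 0 < f x"
    and norm_gauge: "norm x = Inf {r. 0 \<le> r \<and> x \<in> (\<lambda>u. r *\<^sub>R u) ` gauge_ball f}"
    and closed_cone: "closed {x::'a. 0 \<le> x}"

definition markov_operator ::
  "('a::ordered_real_vector \<Rightarrow> real) \<Rightarrow> ('a \<Rightarrow> 'a) \<Rightarrow> bool" where
  "markov_operator f T \<longleftrightarrow> linear T \<and> (\<forall>x. 0 \<le> x \<longrightarrow> 0 \<le> T x) \<and> T ` base f \<subseteq> base f"

definition markov_projection ::
  "('a::ordered_real_vector \<Rightarrow> real) \<Rightarrow> ('a \<Rightarrow> 'a) \<Rightarrow> bool" where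
  "markov_projection f P \<longleftrightarrow> markov_operator f P \<and> P \<circ> P = P"

text \<open>\<open>ndmc T k n\<close> is \<open>T\<^sub>n \<circ> T\<^sub>n\<^sub>-\<^sub>1 \<circ> \<dots> \<circ> T\<^sub>k\<^sub>+\<^sub>1\<close> for \<open>k < n\<close>, and the identity (empty product) for \<open>n \<le> k\<close>.\<close>

primrec ndmc :: "(nat \<Rightarrow> 'a \<Rightarrow> 'a) \<Rightarrow> nat \<Rightarrow> nat \<Rightarrow> 'a \<Rightarrow> 'a" where
  "ndmc T k 0 = id"
| "ndmc T k (Suc n) = (if k < Suc n then T (Suc n) \<circ> ndmc T k n else id)"

definition uniformly_ergodic ::
  "('a::real_normed_vector \<Rightarrow> 'a) \<Rightarrow> (nat \<Rightarrow> 'a \<Rightarrow> 'a) \<Rightarrow> bool" where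
  "uniformly_ergodic P T \<longleftrightarrow>
     (\<forall>m. (\<lambda>n. onorm (\<lambda>x. ndmc T m n x - P x)) \<longlonglongrightarrow> 0)"

text \<open>
  Sequences are indexed by \<open>{1..}\<close>; being extensional, they carry no information at index \<open>0\<close>.
\<close>

definition markov_seqs ::
  "('a::ordered_real_vector \<Rightarrow> real) \<Rightarrow> ('a \<Rightarrow> 'a) \<Rightarrow> (nat \<Rightarrow> 'a \<Rightarrow> 'a) set" where
  "markov_seqs f P =
     (\<Pi>\<^sub>E n\<in>{1..}. {T. markov_operator f T \<and> T \<circ> P = P \<circ> T \<and> T \<circ> P = P})"

definition ergodic_markov_seqs ::
  "('a::{real_normed_vector, ordered_real_vector} \<Rightarrow> real) \<Rightarrow> ('a \<Rightarrow> 'a) \<Rightarrow> (nat \<Rightarrow> 'a \<Rightarrow> 'a) set" where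
  "ergodic_markov_seqs f P = {T \<in> markov_seqs f P. uniformly_ergodic P T}"

text \<open>
  The locale \<open>Metric_space\<close> requires nonnegativity also for arguments outside the carrier,
  where operator norm and series can be meaningless; hence the value \<open>0\<close> there.
\<close>

definition markov_seq_dist ::
  "('a::{real_normed_vector, ordered_real_vector} \<Rightarrow> real) \<Rightarrow> ('a \<Rightarrow> 'a) \<Rightarrow>
   (nat \<Rightarrow> 'a \<Rightarrow> 'a) \<Rightarrow> (nat \<Rightarrow> 'a \<Rightarrow> 'a) \<Rightarrow> real" where
  "markov_seq_dist f P T S =
     (if T \<in> markov_seqs f P \<and> S \<in> markov_seqs f P
      then \<Sum>n. onorm (\<lambda>x. T (Suc n) x - S (Suc n) x) / 2 ^ Suc n else 0)"

context abstract_state_space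
begin

lemma gauge_set_nonempty:
  assumes "(x::'a) \<noteq> 0"
  shows "{r. 0 \<le> r \<and> x \<in> (\<lambda>u. r *\<^sub>R u) ` gauge_ball f} \<noteq> {}"
proof -
  interpret f: linear f by (rule linear_f)
  obtain a b where ab: "0 \<le> a" "0 \<le> b" "x = a - b" using generating by blast
  have fnn: "0 \<le> f y" if "0 \<le> y" for y
    using strictly_positive[of y] that by (cases "y = 0") (auto simp: less_le f.zero)
  have nrm: "(1 / f y) *\<^sub>R y \<in> base f" if "0 \<le> y" "y \<noteq> 0" for y
  proof -
    have "0 < f y" using strictly_positive[of y] that by (simp add: less_le)
    then show ?thesis using that
      by (simp add: base_def f.scaleR scaleR_nonneg_nonneg)
  qed
  have cvx: "convex (gauge_ball f)" by (simp add: gauge_ball_def convex_convex_hull)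
  have sub: "base f \<subseteq> gauge_ball f" "uminus ` base f \<subseteq> gauge_ball f"
    unfolding gauge_ball_def using hull_subset[of "base f \<union> uminus ` base f" convex] by auto
  have "a \<noteq> 0 \<or> b \<noteq> 0" using ab assms by auto
  then obtain c where c: "c \<in> base f" using nrm ab by blast
  have aa: "\<exists>u\<in>base f. a = f a *\<^sub>R u"
  proof (cases "a = 0")
    case True then show ?thesis using c by (auto simp: f.zero)
  next
    case False
    then have "0 < f a" using strictly_positive[of a] ab by (simp add: less_le)
    then show ?thesis using nrm[OF ab(1) False] by (intro bexI) auto
  qed
  have bb: "\<exists>u\<in>base f. b = f b *\<^sub>R u"
  proof (cases "b = 0")
    case True then show ?thesis using c by (auto simp: f.zero)
  next
    case False
    then have "0 < f b" using strictly_positive[of b] ab by (simp add: less_le)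
    then show ?thesis using nrm[OF ab(2) False] by (intro bexI) auto
  qed
  obtain u v where u: "u \<in> base f" "a = f a *\<^sub>R u" and v: "v \<in> base f" "b = f b *\<^sub>R v"
    using aa bb by blast
  define s where "s = f a + f b"
  have fa: "0 \<le> f a" and fb: "0 \<le> f b" using fnn ab by auto
  have "s \<noteq> 0"
  proof
    assume "s = 0"
    then have "f a = 0" "f b = 0" using fa fb by (auto simp: s_def)
    then have "a = 0" "b = 0" using u(2) v(2) by auto
    then show False using \<open>a \<noteq> 0 \<or> b \<noteq> 0\<close> by blast
  qed
  then have spos: "0 < s" using fa fb by (simp add: s_def)
  have "(f a / s) *\<^sub>R u + (f b / s) *\<^sub>R (- v) \<in> gauge_ball f"
    by (rule convexD[OF cvx]) (use u v sub fa fb spos in \<open>auto simp: s_def add_divide_distrib[symmetric]\<close>)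
  moreover have "s *\<^sub>R ((f a / s) *\<^sub>R u + (f b / s) *\<^sub>R (- v)) = x"
  proof -
    have "s *\<^sub>R ((f a / s) *\<^sub>R u + (f b / s) *\<^sub>R (- v)) = f a *\<^sub>R u - f b *\<^sub>R v"
      using spos by (simp add: scaleR_diff_right)
    then show ?thesis using u(2) v(2) ab(3) by simp
  qed
  ultimately show ?thesis using spos by (auto simp: image_iff intro!: exI[of _ s])
qed

lemma markov_operator_contraction:
  assumes "markov_operator f T"
  shows "norm (T x) \<le> norm x"
proof (cases "x = 0")
  case True
  then show ?thesis using assms by (simp add: markov_operator_def linear_0)
next
  case False
  have lin: "linear T" and K: "T ` base f \<subseteq> base f" using assms by (auto simp: markov_operator_def)
  have "T ` gauge_ball f = convex hull (T ` (base f \<union> uminus ` base f))"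
    by (simp add: gauge_ball_def convex_hull_linear_image[OF lin])
  also have "\<dots> \<subseteq> gauge_ball f"
    unfolding gauge_ball_def using K by (intro hull_mono) (auto simp: linear_neg[OF lin])
  finally have U: "T ` gauge_ball f \<subseteq> gauge_ball f" .
  let ?G = "\<lambda>x. {r. 0 \<le> r \<and> x \<in> (\<lambda>u. r *\<^sub>R u) ` gauge_ball f}"
  have "?G x \<subseteq> ?G (T x)"
    using U by (auto simp: linear_scale[OF lin] intro!: imageI)
  moreover have "bdd_below (?G (T x))" by (auto intro: bdd_belowI[of _ 0])
  ultimately have "Inf (?G (T x)) \<le> Inf (?G x)"
    using gauge_set_nonempty[OF False] by (intro cInf_superset_mono)
  then show ?thesis using norm_gauge[of x] norm_gauge[of "T x"] by simp
qed

lemma markov_operator_bounded_linear: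
  assumes "markov_operator f T"
  shows "bounded_linear T"
  by (rule bounded_linear_intro[of _ 1])
    (use assms markov_operator_contraction[OF assms] in
      \<open>auto simp: markov_operator_def linear_add linear_scale\<close>)

lemma markov_operator_onorm_le: "markov_operator f T \<Longrightarrow> onorm T \<le> 1"
  by (rule onorm_bound) (auto simp: markov_operator_contraction)

lemma Metric_space_markov_seqs: "Metric_space (markov_seqs f P) (markov_seq_dist f P)"
proof -
  let ?S = "markov_seqs f P"
  let ?t = "\<lambda>T S n. onorm (\<lambda>x. T (Suc n) x - S (Suc n) x) / 2 ^ Suc n"
  have mk: "markov_operator f (T (Suc n))" if "T \<in> ?S" for T n
    using that by (auto simp: markov_seqs_def PiE_iff)
  have bl: "bounded_linear (\<lambda>x. T (Suc n) x - S (Suc n) x)" if "T \<in> ?S" "S \<in> ?S" for T S n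
    using that by (intro bounded_linear_sub markov_operator_bounded_linear mk)
  have nn: "0 \<le> ?t T S n" if "T \<in> ?S" "S \<in> ?S" for T S n
    using onorm_pos_le[OF bl[OF that]] by simp
  have le: "onorm (\<lambda>x. T (Suc n) x - S (Suc n) x) \<le> 2" if "T \<in> ?S" "S \<in> ?S" for T S n
  proof (rule onorm_bound)
    fix x
    have "norm (T (Suc n) x - S (Suc n) x) \<le> norm (T (Suc n) x) + norm (S (Suc n) x)"
      by (rule norm_triangle_ineq4)
    also have "\<dots> \<le> norm x + norm x"
      using that by (intro add_mono markov_operator_contraction mk)
    finally show "norm (T (Suc n) x - S (Suc n) x) \<le> 2 * norm x" by simp
  qed simp
  have sm: "summable (?t T S)" if "T \<in> ?S" "S \<in> ?S" for T S
  proof (rule summable_comparison_test)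
    show "summable (\<lambda>n. (1/2::real) ^ n)" by (simp add: summable_geometric)
    show "\<exists>N. \<forall>n\<ge>N. norm (?t T S n) \<le> (1/2) ^ n"
      using le[OF that] nn[OF that] by (auto simp: power_one_over field_simps)
  qed
  show ?thesis
  proof
    show "0 \<le> markov_seq_dist f P T S" for T S
      unfolding markov_seq_dist_def using suminf_nonneg[OF sm[of T S] nn[of T S]] by auto
    show "markov_seq_dist f P T S = markov_seq_dist f P S T" for T S
    proof -
      have "onorm (\<lambda>x. T (Suc n) x - S (Suc n) x) = onorm (\<lambda>x. S (Suc n) x - T (Suc n) x)" for n
        using onorm_neg[of "\<lambda>x. T (Suc n) x - S (Suc n) x"] by simp
      then show ?thesis by (auto simp: markov_seq_dist_def)
    qed
    show "markov_seq_dist f P T S = 0 \<longleftrightarrow> T = S" if TS: "T \<in> ?S" "S \<in> ?S" for T S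
    proof -
      have "markov_seq_dist f P T S = 0 \<longleftrightarrow> (\<forall>n. ?t T S n = 0)"
        using suminf_eq_zero_iff[OF sm[of T S] nn[of T S]] TS by (simp add: markov_seq_dist_def)
      also have "\<dots> \<longleftrightarrow> (\<forall>n. T (Suc n) = S (Suc n))"
        using onorm_eq_0[OF bl[OF TS]] by (auto simp: fun_eq_iff)
      also have "\<dots> \<longleftrightarrow> T = S"
      proof
        assume "\<forall>n. T (Suc n) = S (Suc n)"
        then show "T = S"
          using TS unfolding markov_seqs_def
          by (intro PiE_ext) (auto, metis Suc_le_D)
      qed simp
      finally show ?thesis .
    qed
    show "markov_seq_dist f P T R \<le> markov_seq_dist f P T S + markov_seq_dist f P S R"
      if TSR: "T \<in> ?S" "S \<in> ?S" "R \<in> ?S" for T S R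
    proof -
      have "?t T R n \<le> ?t T S n + ?t S R n" for n
        using onorm_triangle[OF bl[OF TSR(1,2), of n] bl[OF TSR(2,3), of n]]
        by (simp add: divide_simps)
      then have "suminf (?t T R) \<le> (\<Sum>n. ?t T S n + ?t S R n)"
        using TSR by (intro suminf_le sm summable_add) auto
      also have "\<dots> = suminf (?t T S) + suminf (?t S R)"
        using TSR by (intro suminf_add[symmetric] sm)
      finally show ?thesis using TSR by (simp add: markov_seq_dist_def)
    qed
  qed
qed

end

end

theory Submission
  imports Defs
begin

text \<open>
  The metric weighs the \<open>n\<close>-th operator with \<open>2\<^sup>-\<^sup>n\<close>, so changing a far tail of a sequence moves it
  only a little, whereas uniform ergodicity depends on the tail alone. Given \<open>\<T>\<close>, replace
  \<open>T\<^sub>n\<close> by \<open>P\<close> for all \<open>n > N\<close>. The operators \<open>T\<^sub>n\<close> and \<open>P\<close> differ by at most \<open>2\<close> in norm, so this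
  moves \<open>\<T>\<close> by at most \<open>2 / 2\<^sup>N\<close> (\<open>markov_seq_dist_replace_tail_le\<close>). Since
  \<open>P T\<^sub>n = P = P\<^sup>2\<close>, any product that ends (on the left) with a factor \<open>P\<close> collapses to \<open>P\<close>
  (\<open>projection_absorbs_ndmc\<close>). Hence the product \<open>T\<^sup>m\<^sup>,\<^sup>n\<close> of the new chain equals \<open>P\<close> for all
  \<open>n > max m N\<close>, and the new chain is uniformly \<open>P\<close>-ergodic.
\<close>

lemma markov_seqs_iff:
  "T \<in> markov_seqs f P \<longleftrightarrow>
    T \<in> extensional {1..} \<and> (\<forall>n\<ge>1. markov_operator f (T n) \<and> T n \<circ> P = P \<and> P \<circ> T n = P)"
proof -
  have "T n \<circ> P = P \<circ> T n \<and> T n \<circ> P = P \<longleftrightarrow> T n \<circ> P = P \<and> P \<circ> T n = P" for n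
    by metis
  then show ?thesis
    unfolding markov_seqs_def PiE_iff mem_Collect_eq by (metis atLeast_iff)
qed

definition replace_tail :: "nat \<Rightarrow> ('a \<Rightarrow> 'a) \<Rightarrow> (nat \<Rightarrow> 'a \<Rightarrow> 'a) \<Rightarrow> nat \<Rightarrow> 'a \<Rightarrow> 'a" where
  "replace_tail N P T = (\<lambda>n\<in>{1..}. if n \<le> N then T n else P)"

lemma replace_tail_in_markov_seqs:
  assumes "markov_projection f P" "T \<in> markov_seqs f P"
  shows "replace_tail N P T \<in> markov_seqs f P"
  using assms by (auto simp: replace_tail_def markov_seqs_iff markov_projection_def)

text \<open>
  Each factor is absorbed from the left, \<open>P T\<^sub>n = P\<close>; this is where the commutation
  \<open>T\<^sub>n P = P T\<^sub>n\<close> enters, as \<open>T\<^sub>n P = P\<close> alone only absorbs from the right.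
\<close>

lemma projection_absorbs_ndmc:
  assumes "T \<in> markov_seqs f P"
  shows "P \<circ> ndmc T m n = P"
proof (induction n)
  case (Suc n)
  have "P \<circ> T (Suc n) = P"
    using assms by (simp add: markov_seqs_iff)
  with Suc show ?case by (simp add: fun_eq_iff)
qed simp

text \<open>
  Once \<open>n > max m N\<close>, the leftmost factor of \<open>T\<^sup>m\<^sup>,\<^sup>n\<close> is \<open>P\<close>, which absorbs all the others, so the
  limit is attained after finitely many steps.
\<close>

lemma uniformly_ergodic_if_eventually_projection:
  assumes T: "T \<in> markov_seqs f P" and tail: "\<And>n. N < n \<Longrightarrow> T n = P"
  shows "uniformly_ergodic P T"
  unfolding uniformly_ergodic_def
proof
  fix m
  have "ndmc T m n = P" if "max m N < n" for n
    using that tail[of n] projection_absorbs_ndmc[OF T, of m "n - 1"] by (cases n) auto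
  then have "onorm (\<lambda>x. ndmc T m n x - P x) = 0" if "max m N < n" for n
    using that by (simp only: diff_self onorm_zero)
  then have "eventually (\<lambda>n. onorm (\<lambda>x. ndmc T m n x - P x) = 0) sequentially"
    by (intro eventually_sequentiallyI[of "Suc (max m N)"]) (simp only: less_eq_Suc_le)
  then show "(\<lambda>n. onorm (\<lambda>x. ndmc T m n x - P x)) \<longlonglongrightarrow> 0"
    by (rule tendsto_eventually)
qed

context abstract_state_space
begin

lemma onorm_markov_diff_le:
  assumes "markov_operator f T" "markov_operator f S"
  shows "onorm (\<lambda>x. T x - S x) \<le> 2"
proof (rule onorm_bound)
  fix x
  show "norm (T x - S x) \<le> 2 * norm x"
    using norm_triangle_ineq4[of "T x" "S x"] markov_operator_contraction[OF assms(1), of x]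
      markov_operator_contraction[OF assms(2), of x] by linarith
qed simp

text \<open>
  The first \<open>N\<close> terms of the series vanish, and the remaining ones are dominated by the geometric
  series with first term \<open>2 / 2\<^sup>N\<^sup>+\<^sup>1\<close> and ratio \<open>1/2\<close>.
\<close>

lemma markov_seq_dist_replace_tail_le:
  assumes P: "markov_projection f P" and T: "T \<in> markov_seqs f P"
  shows "markov_seq_dist f P T (replace_tail N P T) \<le> 2 * (1/2) ^ N"
proof -
  let ?S = "replace_tail N P T"
  define a where "a n = onorm (\<lambda>x. T (Suc n) x - ?S (Suc n) x) / 2 ^ Suc n" for n
  have S: "?S \<in> markov_seqs f P"
    using P T by (rule replace_tail_in_markov_seqs)
  have mk: "markov_operator f (R (Suc n))" if "R \<in> markov_seqs f P" for R n
    using that by (simp add: markov_seqs_iff)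
  have a_nonneg: "0 \<le> a n" for n
    unfolding a_def using T S
    by (intro divide_nonneg_pos onorm_pos_le bounded_linear_sub markov_operator_bounded_linear mk)
      auto
  have a_le: "a n \<le> (1/2) ^ n" for n
    using onorm_markov_diff_le[OF mk[OF T] mk[OF S], of n n]
    by (simp add: a_def field_simps)
  \<comment> \<open>The index is shifted: \<open>a n\<close> compares the operators number \<open>n + 1 \<le> N\<close>, which agree.\<close>
  have a_zero: "a n = 0" if "n < N" for n
    using that by (simp add: a_def replace_tail_def onorm_zero)
  have "summable a"
    by (rule summable_comparison_test[of _ "\<lambda>n. (1/2) ^ n"]) (use a_nonneg a_le in auto)
  then have tail: "(\<lambda>n. a (n + N)) sums suminf a"
    using a_zero by (subst sums_zero_iff_shift) auto
  have "(\<lambda>n. (1/2) ^ N * (1/2) ^ n) sums ((1/2) ^ N * (1 / (1 - 1/2 :: real)))"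
    by (intro sums_mult geometric_sums) simp
  then have "(\<lambda>n. (1/2::real) ^ (n + N)) sums (2 * (1/2) ^ N)"
    by (simp add: power_add mult.commute)
  with tail have "suminf a \<le> 2 * (1/2) ^ N"
    by (rule sums_le[OF a_le])
  then show ?thesis
    using T S unfolding markov_seq_dist_def a_def by simp
qed

end

theorem theorem7p1:
  fixes f :: "'a::{banach, ordered_real_vector} \<Rightarrow> real" and P :: "'a \<Rightarrow> 'a"
  assumes "abstract_state_space f" and "markov_projection f P"
  shows "ergodic_markov_seqs f P \<subseteq> markov_seqs f P \<and>
    Metric_space.mtopology (markov_seqs f P) (markov_seq_dist f P)
      closure_of (ergodic_markov_seqs f P) = markov_seqs f P"
proof
  show sub: "ergodic_markov_seqs f P \<subseteq> markov_seqs f P"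
    by (auto simp: ergodic_markov_seqs_def)
  interpret abstract_state_space f by (rule assms(1))
  interpret M: Metric_space "markov_seqs f P" "markov_seq_dist f P"
    by (rule Metric_space_markov_seqs)
  have "\<exists>S\<in>ergodic_markov_seqs f P. S \<in> M.mball T r"
    if T: "T \<in> markov_seqs f P" and "0 < r" for T r
  proof -
    obtain N where N: "(1/2) ^ N < r / 2"
      using real_arch_pow_inv[of "r / 2" "1/2"] \<open>0 < r\<close> by auto
    let ?S = "replace_tail N P T"
    have S: "?S \<in> markov_seqs f P"
      using assms(2) T by (rule replace_tail_in_markov_seqs)
    have "uniformly_ergodic P ?S"
      using S by (rule uniformly_ergodic_if_eventually_projection[where N = N])
        (auto simp: replace_tail_def)
    moreover have "markov_seq_dist f P T ?S < r"
      using markov_seq_dist_replace_tail_le[OF assms(2) T, of N] N by simp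
    ultimately show ?thesis
      using S T by (intro bexI[of _ ?S]) (auto simp: ergodic_markov_seqs_def)
  qed
  then show "M.mtopology closure_of (ergodic_markov_seqs f P) = markov_seqs f P"
    by (auto simp: M.metric_closure_of)
qed

end
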